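(* Let $N\ge 1$ and consider a finite $N$-player game with stochastic payoffs: each player $i\in[N]=\{1,\dots,N\}$ has a finite nonempty set $S_i$ of pure strategies, and for every $i\in[N]$ and every pure strategy profile $\boldsymbol{s}\in \boldsymbol{S}=S_1\times\cdots\times S_N$ the payoff $U_i(\boldsymbol{s})$ is a real-valued continuous-type random variable (i.e. having a probability density function $f_i(\cdot\mid\boldsymbol{s})$) with mean $u_i(\boldsymbol{s})$, all the payoffs $U_i(\boldsymbol{s})$, $i\in[N]$, $\boldsymbol{s}\in\boldsymbol{S}$, being independent. Then there exists a risk-averse equilibrium, that is, a mixed strategy profile $\boldsymbol{\sigma}^*=(\sigma_1^*,\dots,\sigma_N^* )\in\boldsymbol{\Sigma}$ such that $\sigma_i^*\in RB(\boldsymbol{\sigma}_{-i}^* )$ for all $i\in[N]$, where $RB$ denotes the risk-averse best response set.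
   Context: Notation: $\Sigma_i$ is the set of all probability distributions over $S_i$ (mixed strategies of player $i$), $\boldsymbol{\Sigma}=\Sigma_1\times\cdots\times\Sigma_N$, and $\sigma_i(s_i)$ is the probability that $\sigma_i\in\Sigma_i$ assigns to $s_i\in S_i$. A subscript $-i$ denotes the components of all players other than $i$; $\boldsymbol{S}_{-i}=\prod_{j\ne i}S_j$, and $\boldsymbol{\sigma}(\boldsymbol{s}_{-i})=\prod_{j\in[N]\setminus i}\sigma_j(s_j)$ for $\boldsymbol{s}_{-i}\in\boldsymbol{S}_{-i}$. Payoff against mixed strategies: $\overline{U}_i(s_i,\boldsymbol{\sigma}_{-i})$ is the random payoff of player $i$ when he/she plays $s_i\in S_i$ and the other players play the mixed strategies $\boldsymbol{\sigma}_{-i}$. The same randomness on the actions of the players $[N]\setminus i$ is used for all $s_i\in S_i$: a single random profile $\boldsymbol{s}_{-i}$ is drawn with probability $\boldsymbol{\sigma}(\boldsymbol{s}_{-i})$, independently of the payoffs, and $\overline{U}_i(s_i,\boldsymbol{\sigma}_{-i})=U_i(s_i,\boldsymbol{s}_{-i})$ for all $s_i\in S_i$ simultaneously. The event $\overline{U}_i(s_i,\boldsymbol{\sigma}_{-i})\ge\overline{\boldsymbol{U}}_i(S_i\setminus s_i,\boldsymbol{\sigma}_{-i})$ means that $\overline{U}_i(s_i,\boldsymbol{\sigma}_{-i})\ge\overline{U}_i(s_i',\boldsymbol{\sigma}_{-i})$ for all $s_i'\in S_i\setminus\{s_i\}$. Thus, by the law of total probability, $$P\big(\overline{U}_i(s_i,\boldsymbol{\sigma}_{-i})\ge\overline{\boldsymbol{U}}_i(S_i\setminus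 s_i,\boldsymbol{\sigma}_{-i})\big)=\sum_{\boldsymbol{s}_{-i}\in\boldsymbol{S}_{-i}}\boldsymbol{\sigma}(\boldsymbol{s}_{-i})\,P\big(U_i(s_i,\boldsymbol{s}_{-i})\ge U_i(s_i',\boldsymbol{s}_{-i})\ \ \forall s_i'\in S_i\setminus\{s_i\}\big).$$ Risk-averse best response: $RB(\boldsymbol{\sigma}_{-i})$ is the set of all probability distributions on $S_i$ that are supported on the set $$\operatorname*{arg\,max}_{s_i\in S_i}P\big(\overline{U}_i(s_i,\boldsymbol{\sigma}_{-i})\ge\overline{\boldsymbol{U}}_i(S_i\setminus s_i,\boldsymbol{\sigma}_{-i})\big).$$ If $S_i$ is a singleton, player $i$'s only option is its unique element. *)

theory Defs
  imports "HOL-Probability.Probability"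
begin

text \<open>
  Players are \<open>{1..N}\<close>, \<open>S i\<close> is the set of pure strategies of player \<open>i\<close>, and pure strategy profiles
  are the elements of \<open>Pi\<^sub>E {1..N} S\<close>. The payoffs \<open>U i s\<close> are random variables on \<open>M\<close>. An argument
  \<open>\<sigma>\<close> that stands for the mixed strategies of the opponents of \<open>i\<close> is only used on \<open>{1..N} - {i}\<close>.
\<close>

definition mixed_strategies :: "'a set \<Rightarrow> 'a pmf set" where
  "mixed_strategies A = {p. set_pmf p \<subseteq> A}"

definition opponent_profiles :: "nat \<Rightarrow> (nat \<Rightarrow> 'a set) \<Rightarrow> nat \<Rightarrow> (nat \<Rightarrow> 'a) set" where
  "opponent_profiles N S i = Pi\<^sub>E ({1..N} - {i}) S"

definition opponent_prob :: "nat \<Rightarrow> nat \<Rightarrow> (nat \<Rightarrow> 'a pmf) \<Rightarrow> (nat \<Rightarrow> 'a) \<Rightarrow> real" where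
  "opponent_prob N i \<sigma> t = (\<Prod>j\<in>{1..N} - {i}. pmf (\<sigma> j) (t j))"

text \<open>
  The product measure makes the random profile of the opponents independent of all payoffs. Its
  second factor lives on the finite set of opponent profiles only, because \<open>U i s\<close> is not assumed
  to be measurable when \<open>s\<close> is not a pure strategy profile.
\<close>

definition play_space ::
  "'w measure \<Rightarrow> nat \<Rightarrow> (nat \<Rightarrow> 'a set) \<Rightarrow> nat \<Rightarrow> (nat \<Rightarrow> 'a pmf) \<Rightarrow> ('w \<times> (nat \<Rightarrow> 'a)) measure" where
  "play_space M N S i \<sigma> =
     M \<Otimes>\<^sub>M point_measure (opponent_profiles N S i) (\<lambda>t. ennreal (opponent_prob N i \<sigma> t))"

definition random_payoff ::
  "(nat \<Rightarrow> (nat \<Rightarrow> 'a) \<Rightarrow> 'w \<Rightarrow> real) \<Rightarrow> nat \<Rightarrow> 'a \<Rightarrow> 'w \<times> (nat \<Rightarrow> 'a) \<Rightarrow> real" where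
  "random_payoff U i a = (\<lambda>(\<omega>, t). U i (t(i := a)) \<omega>)"

definition prob_best ::
  "'w measure \<Rightarrow> nat \<Rightarrow> (nat \<Rightarrow> 'a set) \<Rightarrow> (nat \<Rightarrow> (nat \<Rightarrow> 'a) \<Rightarrow> 'w \<Rightarrow> real) \<Rightarrow>
     nat \<Rightarrow> (nat \<Rightarrow> 'a pmf) \<Rightarrow> 'a \<Rightarrow> real" where
  "prob_best M N S U i \<sigma> a =
     \<P>(x in play_space M N S i \<sigma>. \<forall>b\<in>S i - {a}. random_payoff U i a x \<ge> random_payoff U i b x)"

definition risk_averse_best_response ::
  "'w measure \<Rightarrow> nat \<Rightarrow> (nat \<Rightarrow> 'a set) \<Rightarrow> (nat \<Rightarrow> (nat \<Rightarrow> 'a) \<Rightarrow> 'w \<Rightarrow> real) \<Rightarrow>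
     nat \<Rightarrow> (nat \<Rightarrow> 'a pmf) \<Rightarrow> 'a pmf set" where
  "risk_averse_best_response M N S U i \<sigma> =
     {p. set_pmf p \<subseteq> {a. is_arg_max (prob_best M N S U i \<sigma>) (\<lambda>a. a \<in> S i) a}}"

definition risk_averse_equilibrium ::
  "'w measure \<Rightarrow> nat \<Rightarrow> (nat \<Rightarrow> 'a set) \<Rightarrow> (nat \<Rightarrow> (nat \<Rightarrow> 'a) \<Rightarrow> 'w \<Rightarrow> real) \<Rightarrow>
     (nat \<Rightarrow> 'a pmf) \<Rightarrow> bool" where
  "risk_averse_equilibrium M N S U \<sigma> \<longleftrightarrow>
     \<sigma> \<in> (\<Pi>\<^sub>E i\<in>{1..N}. mixed_strategies (S i)) \<and>
     (\<forall>i\<in>{1..N}. \<sigma> i \<in> risk_averse_best_response M N S U i \<sigma>)"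

end

theory Submission
  imports Defs
begin

text \<open>
  By the law of total probability, the probability that \<open>a\<close> is a best reply to \<open>\<sigma>\<close> is a polynomial in
  the probabilities \<open>pmf (\<sigma> j) b\<close>, with coefficients \<open>P(U\<^sub>i(a, t) \<ge> U\<^sub>i(b, t) for all b)\<close>. A risk-averse
  equilibrium is therefore a Nash equilibrium of a deterministic finite game, and Nash's argument
  applies: a fixed point of \<open>z(i, a) \<mapsto> (z(i, a) + g(i, a)) / (1 + \<Sum>\<^sub>b g(i, b))\<close>, where \<open>g\<close> is the positive
  part of the gain over the mean payoff, is an equilibrium. The dimension is the number of pairs
  \<open>(i, a)\<close>, a number and not a type, so Brouwer's theorem is needed for a cube indexed by a finite
  set; it follows from Kuhn's combinatorial lemma by compactness.
\<close>

section \<open>Brouwer's fixed point theorem on a cube with finitely many axes\<close>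

text \<open>Cut the cube into cells of side 1/p and label each coordinate of a grid point by whether
  \<open>f\<close> moves it up or down. Kuhn's lemma finds a cell on which every coordinate carries
  both labels. As p grows, a subsequence of such cells shrinks to a point, where continuity turns
  the two opposite inequalities into an equality.\<close>

lemma brouwer_unit_cube:
  fixes f :: "('b \<Rightarrow> real) \<Rightarrow> 'b \<Rightarrow> real"
  assumes "finite I"
    and cont: "\<And>i. i \<in> I \<Longrightarrow> continuous_on (Pi\<^sub>E I (\<lambda>_. {0..1})) (\<lambda>x. f x i)"
    and range: "\<And>x i. x \<in> Pi\<^sub>E I (\<lambda>_. {0..1}) \<Longrightarrow> i \<in> I \<Longrightarrow> f x i \<in> {0..1}"
  obtains x where "x \<in> Pi\<^sub>E I (\<lambda>_. {0..1})" and "\<And>i. i \<in> I \<Longrightarrow> f x i = x i"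
proof -
  define C where "C = Pi\<^sub>E I (\<lambda>_. {0..1::real})"
  define n where "n = card I"
  obtain h where h: "bij_betw h {..<n} I"
    using ex_bij_betw_nat_finite[OF \<open>finite I\<close>] by (auto simp: n_def atLeast0LessThan)
  define g where "g = inv_into {..<n} h"
  have gh: "g (h k) = k" if "k < n" for k
    using h that by (simp add: g_def bij_betw_inv_into_left)
  have hg: "h (g i) = i" if "i \<in> I" for i
    using h that by (simp add: g_def bij_betw_inv_into_right)
  have g_less: "g i < n" if "i \<in> I" for i
    using bij_betwE[OF bij_betw_inv_into[OF h]] that by (auto simp: g_def)
  have h_in: "h k \<in> I" if "k < n" for k
    using bij_betwE[OF h] that by auto
  \<comment> \<open>Only \<open>q\<close> is common to all coordinates; the witnesses
    \<open>r\<close> and \<open>s\<close> depend on \<open>i\<close>. Staying within 1/(m+1) of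
    \<open>q\<close>, they inherit its limit.\<close>
  have approx: "\<exists>q\<in>C. \<forall>i\<in>I. \<exists>r\<in>C. \<exists>s\<in>C. (\<forall>j\<in>I. \<bar>r j - q j\<bar> \<le> 1 / real (Suc m)) \<and>
      (\<forall>j\<in>I. \<bar>s j - q j\<bar> \<le> 1 / real (Suc m)) \<and> r i \<le> f r i \<and> f s i \<le> s i" for m
  proof -
    define p where "p = Suc m"
    define pt where "pt q = restrict (\<lambda>i. real (q (g i)) / real p) I" for q :: "nat \<Rightarrow> nat"
    \<comment> \<open>Kuhn's lemma demands label 1 on the whole upper face, even where
      \<open>f\<close> fixes the coordinate, hence the exception at \<open>q k = p\<close>. There
      \<open>f\<close> is at most 1, so label 1 still implies that \<open>f\<close> does not raise
      the coordinate.\<close>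
    define lab where "lab q k =
      (if pt q (h k) \<le> f (pt q) (h k) \<and> q k \<noteq> p then 0 else 1::nat)" for q k
    have pt_C: "pt q \<in> C" if "\<forall>k<n. q k \<le> p" for q
    proof -
      have "real (q (g i)) \<le> real p" if "i \<in> I" for i
        using \<open>\<forall>k<n. q k \<le> p\<close> g_less[OF that] by simp
      then show ?thesis by (auto simp: pt_def C_def p_def)
    qed
    have pt_h: "pt q (h k) = real (q k) / real p" if "k < n" for q k
      using that by (simp add: pt_def gh h_in)
    have f01: "0 \<le> f (pt q) i" "f (pt q) i \<le> 1" if "\<forall>k<n. q k \<le> p" "i \<in> I" for q i
      using range[of "pt q" i] pt_C[OF that(1)] that(2) by (auto simp: C_def)
    have lab0: "\<forall>x. (\<forall>k<n. x k \<le> p) \<longrightarrow> (\<forall>k<n. x k = 0 \<longrightarrow> lab x k = 0)"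
      using f01 h_in by (auto simp: lab_def pt_h p_def)
    have lab1: "\<forall>x. (\<forall>k<n. x k \<le> p) \<longrightarrow> (\<forall>k<n. x k = p \<longrightarrow> lab x k = 1)"
      by (auto simp: lab_def)
    obtain q where q: "\<forall>k<n. q k < p"
      and q': "\<forall>k<n. \<exists>r s. (\<forall>j<n. q j \<le> r j \<and> r j \<le> q j + 1) \<and>
        (\<forall>j<n. q j \<le> s j \<and> s j \<le> q j + 1) \<and> lab r k \<noteq> lab s k"
    proof (rule kuhn_lemma[of p n lab])
      show "\<forall>x. (\<forall>i<n. x i \<le> p) \<longrightarrow> (\<forall>i<n. lab x i = 0 \<or> lab x i = 1)"
        by (simp add: lab_def)
    qed (use lab0 lab1 in \<open>auto simp: p_def\<close>)
    have near: "\<forall>k<n. r k \<le> p" "\<forall>j\<in>I. \<bar>pt r j - pt q j\<bar> \<le> 1 / real p"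
      if r: "\<forall>j<n. q j \<le> r j \<and> r j \<le> q j + 1" for r
    proof -
      show "\<forall>k<n. r k \<le> p"
        using r q by fastforce
      show "\<forall>j\<in>I. \<bar>pt r j - pt q j\<bar> \<le> 1 / real p"
      proof
        fix j assume j: "j \<in> I"
        have "\<bar>pt r j - pt q j\<bar> = \<bar>real (r (g j)) - real (q (g j))\<bar> / real p"
          using j by (simp add: pt_def flip: diff_divide_distrib)
        also have "\<dots> \<le> 1 / real p"
          using r g_less[OF j] by (intro divide_right_mono) fastforce+
        finally show "\<bar>pt r j - pt q j\<bar> \<le> 1 / real p" .
      qed
    qed
    have above: "pt r (h k) \<le> f (pt r) (h k)" if "lab r k = 0" for r k
      using that by (simp add: lab_def split: if_splits)
    have below: "f (pt r) (h k) \<le> pt r (h k)" if "lab r k \<noteq> 0" "k < n" "\<forall>k<n. r k \<le> p" for r k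
      using that f01[OF that(3) h_in[OF that(2)]]
      by (cases "r k = p") (auto simp: lab_def pt_h p_def split: if_splits)
    have "\<exists>r\<in>C. \<exists>s\<in>C. (\<forall>j\<in>I. \<bar>r j - pt q j\<bar> \<le> 1 / real p) \<and>
      (\<forall>j\<in>I. \<bar>s j - pt q j\<bar> \<le> 1 / real p) \<and> r i \<le> f r i \<and> f s i \<le> s i" if i: "i \<in> I" for i
    proof -
      have k: "g i < n" "h (g i) = i" using i g_less hg by auto
      obtain r s where r: "\<forall>j<n. q j \<le> r j \<and> r j \<le> q j + 1"
        and s: "\<forall>j<n. q j \<le> s j \<and> s j \<le> q j + 1" and ne: "lab r (g i) \<noteq> lab s (g i)"
        using q' k by blast
      \<comment> \<open>Kuhn's lemma says only that the two labels differ; swap the points if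
        necessary so that the first carries 0.\<close>
      obtain r' s' where r': "\<forall>j<n. q j \<le> r' j \<and> r' j \<le> q j + 1" "lab r' (g i) = 0"
        and s': "\<forall>j<n. q j \<le> s' j \<and> s' j \<le> q j + 1" "lab s' (g i) \<noteq> 0"
      proof (cases "lab r (g i) = 0")
        case True
        with ne r s show ?thesis by (intro that[of r s]) auto
      next
        case False
        with ne have "lab s (g i) = 0" by (simp add: lab_def split: if_splits)
        with False r s show ?thesis by (intro that[of s r]) auto
      qed
      show ?thesis
        using near[OF r'(1)] near[OF s'(1)] above[OF r'(2)] below[OF s'(2)] k pt_C
        by (intro bexI[of _ "pt r'"] bexI[of _ "pt s'"]) auto
    qed
    then show ?thesis
      using pt_C[of q] q by (intro bexI[of _ "pt q"]) (auto simp: p_def less_imp_le)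
  qed
  then obtain Q where Q: "\<And>m. Q m \<in> C"
    and Q': "\<And>m. \<forall>i\<in>I. \<exists>r\<in>C. \<exists>s\<in>C. (\<forall>j\<in>I. \<bar>r j - Q m j\<bar> \<le> 1 / real (Suc m)) \<and>
      (\<forall>j\<in>I. \<bar>s j - Q m j\<bar> \<le> 1 / real (Suc m)) \<and> r i \<le> f r i \<and> f s i \<le> s i"
    by metis
  \<comment> \<open>The index type of the cube need not be countable, so sequential compactness is
    not at hand there. Enumerating \<open>I\<close> and padding with 0 moves the sequence to
    functions on the naturals, which form a metric space.\<close>
  define y where "y m k = (if k < n then Q m (h k) else 0)" for m k
  have "compactin (product_topology (\<lambda>_::nat. euclidean) UNIV) (Pi\<^sub>E UNIV (\<lambda>_::nat. {0..1::real}))"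
    by (simp add: compactin_PiE)
  then have "compact (Pi\<^sub>E UNIV (\<lambda>_::nat. {0..1::real}))"
    by (simp add: euclidean_product_topology)
  moreover have "y m \<in> Pi\<^sub>E UNIV (\<lambda>_::nat. {0..1::real})" for m
    using PiE_mem[OF Q[of m, unfolded C_def] h_in] by (auto simp: y_def)
  ultimately obtain l \<rho> where l: "l \<in> Pi\<^sub>E UNIV (\<lambda>_::nat. {0..1::real})"
    and \<rho>: "strict_mono (\<rho> :: nat \<Rightarrow> nat)" and lim: "(y \<circ> \<rho>) \<longlonglongrightarrow> l"
    unfolding compact_def by meson
  define x where "x = restrict (\<lambda>i. l (g i)) I"
  have x: "x \<in> C" using l by (auto simp: x_def C_def)
  have Qlim: "(\<lambda>m. Q (\<rho> m) i) \<longlonglongrightarrow> x i" if "i \<in> I" for i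
  proof -
    have "(\<lambda>m. (y \<circ> \<rho>) m (g i)) \<longlonglongrightarrow> l (g i)"
      by (rule continuous_on_tendsto_compose[OF continuous_on_product_coordinates lim]) auto
    then show ?thesis using that by (simp add: y_def x_def g_less hg)
  qed
  have lim_f: "(\<lambda>m. f (R m) i) \<longlonglongrightarrow> f x i" "(\<lambda>m. R m i) \<longlonglongrightarrow> x i"
    if R: "\<And>m. R m \<in> C" "\<And>m j. j \<in> I \<Longrightarrow> \<bar>R m j - Q (\<rho> m) j\<bar> \<le> 1 / real (Suc (\<rho> m))"
      and i: "i \<in> I" for R i
  proof -
    \<comment> \<open>Convergence in the full product topology concerns the coordinates outside
      \<open>I\<close> too. By extensionality all points of \<open>C\<close> agree there.\<close>
    have co: "(\<lambda>m. R m j) \<longlonglongrightarrow> x j" for j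
    proof (cases "j \<in> I")
      case True
      have "(\<lambda>m. 1 / real (Suc (\<rho> m))) \<longlonglongrightarrow> 0"
        using LIMSEQ_subseq_LIMSEQ[OF LIMSEQ_Suc[OF lim_1_over_n] \<rho>] by (simp add: o_def)
      then have "(\<lambda>m. R m j - Q (\<rho> m) j) \<longlonglongrightarrow> 0"
        by (rule Lim_null_comparison[rotated]) (use R True in auto)
      from tendsto_add[OF this Qlim[OF True]] show ?thesis by simp
    next
      case False
      then have "R m j = x j" for m
        using PiE_arb[OF R(1)[unfolded C_def] False] PiE_arb[OF x[unfolded C_def] False] by simp
      then show ?thesis by simp
    qed
    then show "(\<lambda>m. R m i) \<longlonglongrightarrow> x i" by blast
    have "limitin (product_topology (\<lambda>_. euclidean) UNIV) R x sequentially"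
      using co by (simp add: limitin_componentwise)
    then have "R \<longlonglongrightarrow> x"
      by (simp add: euclidean_product_topology)
    then show "(\<lambda>m. f (R m) i) \<longlonglongrightarrow> f x i"
      using R x by (intro continuous_on_tendsto_compose[OF cont[OF i]]) (auto simp: C_def)
  qed
  have "f x i = x i" if i: "i \<in> I" for i
  proof -
    have "\<forall>m. \<exists>r s. r \<in> C \<and> s \<in> C \<and> (\<forall>j\<in>I. \<bar>r j - Q (\<rho> m) j\<bar> \<le> 1 / real (Suc (\<rho> m))) \<and>
      (\<forall>j\<in>I. \<bar>s j - Q (\<rho> m) j\<bar> \<le> 1 / real (Suc (\<rho> m))) \<and> r i \<le> f r i \<and> f s i \<le> s i"
      using Q' i by blast
    then obtain r s where rs: "\<And>m. r m \<in> C" "\<And>m. s m \<in> C"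
      "\<And>m j. j \<in> I \<Longrightarrow> \<bar>r m j - Q (\<rho> m) j\<bar> \<le> 1 / real (Suc (\<rho> m))"
      "\<And>m j. j \<in> I \<Longrightarrow> \<bar>s m j - Q (\<rho> m) j\<bar> \<le> 1 / real (Suc (\<rho> m))"
      "\<And>m. r m i \<le> f (r m) i" "\<And>m. f (s m) i \<le> s m i"
      unfolding choice_iff by blast
    have lr: "(\<lambda>m. f (r m) i) \<longlonglongrightarrow> f x i" "(\<lambda>m. r m i) \<longlonglongrightarrow> x i"
      by (rule lim_f[OF rs(1,3) i]; assumption)+
    have ls: "(\<lambda>m. f (s m) i) \<longlonglongrightarrow> f x i" "(\<lambda>m. s m i) \<longlonglongrightarrow> x i"
      by (rule lim_f[OF rs(2,4) i]; assumption)+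
    have "x i \<le> f x i" by (rule LIMSEQ_le[OF lr(2,1)]) (use rs in auto)
    moreover have "f x i \<le> x i" by (rule LIMSEQ_le[OF ls]) (use rs in auto)
    ultimately show ?thesis by simp
  qed
  with x show thesis by (intro that) (auto simp: C_def)
qed

section \<open>Nash's fixed point argument on a product of simplices\<close>

text \<open>At a fixed point \<open>z\<close> of Nash's map, the gains are proportional to the
  weights. A positive total gain would make every choice in the support strictly better than the
  weighted mean, which is absurd. So nothing beats the mean, and every choice in the support attains
  it.\<close>

lemma simplices_arg_max_fixpoint:
  fixes v :: "('i \<times> 'a \<Rightarrow> real) \<Rightarrow> 'i \<Rightarrow> 'a \<Rightarrow> real"
  assumes "finite J"
    and S: "\<And>i. i \<in> J \<Longrightarrow> finite (S i) \<and> S i \<noteq> {}"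
    and cont: "\<And>i a. i \<in> J \<Longrightarrow> a \<in> S i \<Longrightarrow> continuous_on UNIV (\<lambda>x. v x i a)"
  obtains x where "\<And>i a. i \<in> J \<Longrightarrow> a \<in> S i \<Longrightarrow> 0 \<le> x (i, a)"
    and "\<And>i. i \<in> J \<Longrightarrow> (\<Sum>a\<in>S i. x (i, a)) = 1"
    and "\<And>i a b. i \<in> J \<Longrightarrow> a \<in> S i \<Longrightarrow> b \<in> S i \<Longrightarrow> x (i, a) \<noteq> 0 \<Longrightarrow> v x i b \<le> v x i a"
proof -
  define I where "I = Sigma J S"
  define total where "total x i = (\<Sum>a\<in>S i. x (i, a))" for x :: "'i \<times> 'a \<Rightarrow> real" and i
  \<comment> \<open>\<open>retr\<close> maps the cube into the product of the simplices and fixes the simplices pointwise: a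
    deficit of the coordinate sum is spread evenly, an excess is divided out.\<close>
  define retr where "retr x = (\<lambda>(i, a).
    (x (i, a) + max 0 (1 - total x i) * (1 / real (card (S i)))) / max 1 (total x i))"
    for x :: "'i \<times> 'a \<Rightarrow> real"
  define mean where "mean z i = (\<Sum>a\<in>S i. z (i, a) * v z i a)" for z i
  define gain where "gain z i a = max 0 (v z i a - mean z i)" for z i a
  define F where "F z = (\<lambda>(i, a). (z (i, a) + gain z i a) / (1 + (\<Sum>b\<in>S i. gain z i b)))" for z
  have retr_sum: "(\<Sum>a\<in>S i. retr x (i, a)) = 1" if "i \<in> J" for x i
  proof -
    have "(\<Sum>a\<in>S i. retr x (i, a)) = (total x i + max 0 (1 - total x i)) / max 1 (total x i)"
      using S[OF that] by (simp add: retr_def total_def sum.distrib flip: sum_divide_distrib)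
    then show ?thesis by (simp add: max_def)
  qed
  have retr_nonneg: "0 \<le> retr x (i, a)" if "x \<in> Pi\<^sub>E I (\<lambda>_. {0..1})" "i \<in> J" "a \<in> S i" for x i a
  proof -
    have "(i, a) \<in> I" using that by (simp add: I_def)
    then have "0 \<le> x (i, a)" using that(1) by fastforce
    then show ?thesis by (simp add: retr_def)
  qed
  have retr_id: "retr x (i, a) = x (i, a)" if "total x i = 1" for x i a
    using that by (simp add: retr_def)
  have gain_nonneg: "0 \<le> gain z i a" for z i a by (simp add: gain_def)
  have gain_sum: "0 < 1 + (\<Sum>b\<in>S i. gain z i b)" for z i
    by (intro add_pos_nonneg sum_nonneg gain_nonneg) simp
  have F_nonneg: "0 \<le> F z (i, a)" if "0 \<le> z (i, a)" for z i a
    using that gain_nonneg[of z i a] gain_sum[of z i] by (simp add: F_def)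
  have F_sum: "total (F z) i = 1" if "total z i = 1" for z i
    using that gain_sum[of z i]
    by (simp add: F_def total_def sum.distrib flip: sum_divide_distrib)
  have cont_retr: "continuous_on A retr" for A
  proof (rule continuous_on_coordinatewise_then_product)
    fix p :: "'i \<times> 'a"
    obtain i a where p: "p = (i, a)" by fastforce
    have co: "continuous_on A (\<lambda>x. x q)" for q :: "'i \<times> 'a"
      by (rule continuous_on_subset[OF continuous_on_product_coordinates]) simp
    show "continuous_on A (\<lambda>x. retr x p)"
      unfolding retr_def p total_def prod.case
      by (intro continuous_intros co) (auto simp: max_def)
  qed
  have cont_F: "continuous_on UNIV (\<lambda>z. F z (i, a))" if ia: "i \<in> J" "a \<in> S i" for i a
  proof -
    have m: "continuous_on UNIV (\<lambda>z. mean z i)"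
      unfolding mean_def by (intro continuous_intros continuous_on_product_coordinates cont ia)
    have g: "continuous_on UNIV (\<lambda>z. gain z i b)" if "b \<in> S i" for b
      unfolding gain_def by (intro continuous_intros m cont ia that)
    then show ?thesis
      unfolding F_def prod.case
      by (intro continuous_intros continuous_on_product_coordinates g ia)
        (use gain_sum in \<open>auto simp: less_imp_neq[THEN not_sym]\<close>)
  qed
  have "finite I" using S \<open>finite J\<close> by (auto simp: I_def)
  \<comment> \<open>Brouwer's theorem is available on the cube, not on the simplices, so it is
    applied to \<open>F\<close> after \<open>retr\<close>.\<close>
  then obtain x where x: "x \<in> Pi\<^sub>E I (\<lambda>_. {0..1})"
    and fixpt: "\<And>p. p \<in> I \<Longrightarrow> F (retr x) p = x p"
  proof (rule brouwer_unit_cube[where f = "\<lambda>x. F (retr x)"])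
    fix p assume "p \<in> I"
    then obtain i a where p: "p = (i, a)" and ia: "i \<in> J" "a \<in> S i" by (auto simp: I_def)
    show "continuous_on (Pi\<^sub>E I (\<lambda>_. {0..1})) (\<lambda>x. F (retr x) p)"
      unfolding p by (rule continuous_on_compose2[OF cont_F[OF ia] cont_retr]) simp
    fix x :: "'i \<times> 'a \<Rightarrow> real" assume x: "x \<in> Pi\<^sub>E I (\<lambda>_. {0..1})"
    have nn: "0 \<le> F (retr x) (i, b)" if "b \<in> S i" for b
      using F_nonneg retr_nonneg[OF x ia(1) that] .
    have "F (retr x) (i, a) \<le> total (F (retr x)) i"
      unfolding total_def using S[OF ia(1)] ia(2) nn by (intro member_le_sum) auto
    then show "F (retr x) p \<in> {0..1}"
      using nn[OF ia(2)] F_sum[of "retr x" i] retr_sum[OF ia(1), of x] by (simp add: p total_def)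
  qed auto
  define z where "z = retr x"
  have z_sum: "total z i = 1" if "i \<in> J" for i
    using retr_sum[OF that] by (simp add: z_def total_def)
  have z_nonneg: "0 \<le> z (i, a)" if "i \<in> J" "a \<in> S i" for i a
    using retr_nonneg[OF x that] by (simp add: z_def)
  \<comment> \<open>The fixed point \<open>x\<close> is a value of \<open>F\<close> at a point of
    the simplices, so its coordinate sums are 1. Hence \<open>retr\<close> leaves it unchanged, and
    \<open>z\<close> agrees with \<open>x\<close> on \<open>I\<close>.\<close>
  have F_z: "F z (i, a) = z (i, a)" if ia: "i \<in> J" "a \<in> S i" for i a
  proof -
    have "total x i = total (F z) i"
      using fixpt ia(1) by (simp add: total_def z_def I_def)
    then have "total x i = 1" using F_sum[OF z_sum[OF ia(1)]] by simp
    then show ?thesis using retr_id fixpt[of "(i, a)"] ia by (simp add: z_def I_def)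
  qed
  have supp: "v z i b \<le> v z i a" if i: "i \<in> J" and ab: "a \<in> S i" "b \<in> S i" "z (i, a) \<noteq> 0" for i a b
  proof -
    define G where "G = (\<Sum>b\<in>S i. gain z i b)"
    have avg: "(\<Sum>c\<in>S i. z (i, c) * (v z i c - mean z i)) = 0"
      using z_sum[OF i]
      by (simp add: right_diff_distrib sum_subtractf mean_def total_def flip: sum_distrib_right)
    have gain_eq: "z (i, c) * G = gain z i c" if "c \<in> S i" for c
      using F_z[OF i that] gain_sum[of z i] by (simp add: F_def G_def field_simps)
    \<comment> \<open>If \<open>G\<close> were positive, a nonzero weight would force a positive
      gain, so all terms of \<open>avg\<close> would be nonnegative and therefore zero. By
      \<open>gain_eq\<close> every weight would then vanish, contradicting the sum 1.\<close>
    have "G = 0"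
    proof (rule ccontr)
      assume "G \<noteq> 0"
      then have "G > 0" using sum_nonneg[of "S i" "gain z i"] gain_nonneg by (simp add: G_def less_le)
      have *: "0 \<le> z (i, c) * (v z i c - mean z i)" if "c \<in> S i" for c
      proof (cases "z (i, c) = 0")
        case False
        then have "gain z i c > 0"
          using gain_eq[OF that] \<open>G > 0\<close> z_nonneg[OF i that] by (metis less_le mult_pos_pos)
        then show ?thesis using z_nonneg[OF i that] by (simp add: gain_def)
      qed simp
      have "z (i, c) * (v z i c - mean z i) = 0" if "c \<in> S i" for c
        using sum_nonneg_eq_0_iff[of "S i" "\<lambda>c. z (i, c) * (v z i c - mean z i)"] S[OF i] * avg that
        by auto
      with gain_eq \<open>G > 0\<close> have "z (i, c) = 0" if "c \<in> S i" for c
        using that by (force simp: gain_def)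
      then have "total z i = 0" by (simp add: total_def)
      with z_sum[OF i] show False by simp
    qed
    then have le: "v z i c \<le> mean z i" if "c \<in> S i" for c
      using gain_eq[OF that] by (simp add: gain_def max_def split: if_splits)
    \<comment> \<open>The same average with the sign reversed: by \<open>le\<close> its terms are
      now nonnegative, so each of them is zero.\<close>
    have "(\<Sum>c\<in>S i. z (i, c) * (mean z i - v z i c)) = 0"
      using avg by (simp add: right_diff_distrib sum_subtractf)
    then have "\<forall>c\<in>S i. z (i, c) * (mean z i - v z i c) = 0"
      using le z_nonneg[OF i] S[OF i] by (subst sum_nonneg_eq_0_iff[symmetric]) auto
    then have "v z i a = mean z i" using ab by auto
    then show ?thesis using le ab by simp
  qed
  show thesis
    using z_nonneg z_sum supp by (intro that[of z]) (auto simp: total_def)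
qed

section \<open>The law of total probability for the best-reply event\<close>

text \<open>The event is a finite disjoint union of rectangles, one over each point of
  \<open>A\<close>. This needs measurability only of the slices at points of \<open>A\<close>, which
  suits payoffs known to be measurable only at pure strategy profiles.\<close>

lemma measure_pair_point_measure:
  assumes "finite_measure M" and A: "finite A" and w: "\<And>t. t \<in> A \<Longrightarrow> 0 \<le> w t"
    and meas: "\<And>t. t \<in> A \<Longrightarrow> {\<omega> \<in> space M. P \<omega> t} \<in> sets M"
  defines "K \<equiv> M \<Otimes>\<^sub>M point_measure A (\<lambda>t. ennreal (w t))"
  shows "measure K {x \<in> space K. P (fst x) (snd x)} = (\<Sum>t\<in>A. w t * measure M {\<omega> \<in> space M. P \<omega> t})"
proof -
  interpret finite_measure M by fact
  let ?W = "point_measure A (\<lambda>t. ennreal (w t))"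
  interpret W: finite_measure ?W
    by (rule finite_measureI)
      (simp add: emeasure_point_measure_finite A space_point_measure)
  define E where "E t = {\<omega> \<in> space M. P \<omega> t} \<times> {t}" for t
  have E: "E t \<in> sets K" if "t \<in> A" for t
    unfolding E_def K_def using meas[OF that] that by (intro pair_measureI) (auto simp: sets_point_measure)
  have emE: "emeasure K (E t) = ennreal (w t * measure M {\<omega> \<in> space M. P \<omega> t})" if "t \<in> A" for t
    unfolding E_def K_def using meas[OF that] that w[OF that] A
    by (subst W.emeasure_pair_measure_Times)
      (auto simp: sets_point_measure emeasure_point_measure_finite emeasure_eq_measure
        ennreal_mult mult.commute)
  have "{x \<in> space K. P (fst x) (snd x)} = (\<Union>t\<in>A. E t)"
    by (auto simp: K_def E_def space_pair_measure space_point_measure)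
  then have "emeasure K {x \<in> space K. P (fst x) (snd x)} = (\<Sum>t\<in>A. emeasure K (E t))"
    using E A by (subst sum_emeasure) (auto simp: disjoint_family_on_def E_def)
  also have "\<dots> = ennreal (\<Sum>t\<in>A. w t * measure M {\<omega> \<in> space M. P \<omega> t})"
    using w by (simp add: emE)
  finally show ?thesis
    using w by (simp add: measure_def[of K] sum_nonneg)
qed

text \<open>Conditioning on the opponents' profile exposes the objective as a polynomial in their
  probabilities, hence as a continuous function of them.\<close>

lemma prob_best_eq_sum:
  assumes "finite_measure M" and S: "\<And>j. j \<in> {1..N} \<Longrightarrow> finite (S j)"
    and i: "i \<in> {1..N}" and a: "a \<in> S i"
    and meas: "\<And>s. s \<in> Pi\<^sub>E {1..N} S \<Longrightarrow> U i s \<in> borel_measurable M"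
  shows "prob_best M N S U i \<sigma> a = (\<Sum>t\<in>opponent_profiles N S i. opponent_prob N i \<sigma> t *
    \<P>(\<omega> in M. \<forall>b\<in>S i - {a}. U i (t(i := a)) \<omega> \<ge> U i (t(i := b)) \<omega>))"
proof -
  have fin: "finite (opponent_profiles N S i)"
    unfolding opponent_profiles_def using S by (intro finite_PiE) auto
  have ms: "{\<omega> \<in> space M. \<forall>b\<in>S i - {a}. U i (t(i := a)) \<omega> \<ge> U i (t(i := b)) \<omega>} \<in> sets M"
    if "t \<in> opponent_profiles N S i" for t
  proof -
    have "U i (t(i := b)) \<in> borel_measurable M" if "b \<in> S i" for b
      using \<open>t \<in> _\<close> that i
      by (intro meas) (auto simp: opponent_profiles_def PiE_def extensional_def)
    then show ?thesis
      using S[OF i] a by (intro sets.sets_Collect_finite_All' sets.sets_Collect_finite_All borel_measurable_le) auto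
  qed
  show ?thesis
    using measure_pair_point_measure[where P = "\<lambda>\<omega> t. \<forall>b\<in>S i - {a}. U i (t(i := a)) \<omega> \<ge> U i (t(i := b)) \<omega>",
        OF assms(1) fin _ ms, of "opponent_prob N i \<sigma>"]
    by (simp add: prob_best_def play_space_def random_payoff_def case_prod_unfold
        opponent_prob_def prod_nonneg)
qed

section \<open>From the fixed point to a risk-averse equilibrium\<close>

lemma ex_pmf_on_finite:
  assumes "finite A" and "\<And>a. a \<in> A \<Longrightarrow> 0 \<le> w a" and "(\<Sum>a\<in>A. w a) = 1"
  shows "\<exists>p. \<forall>a. pmf p a = (if a \<in> A then w a else 0)"
proof (intro exI allI)
  fix a
  have "(\<integral>\<^sup>+a. ennreal (if a \<in> A then w a else 0) \<partial>count_space UNIV) =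
    (\<Sum>a\<in>A. ennreal (if a \<in> A then w a else 0))"
    using assms(1) by (intro nn_integral_count_space') auto
  also have "\<dots> = 1" using assms by (simp add: sum_ennreal)
  finally show "pmf (embed_pmf (\<lambda>a. if a \<in> A then w a else 0)) a = (if a \<in> A then w a else 0)"
    using assms(2) by (subst pmf_embed_pmf) auto
qed

theorem theorem1:
  fixes M :: "'w measure"
    and N :: nat
    and S :: "nat \<Rightarrow> 'a set"
    and U :: "nat \<Rightarrow> (nat \<Rightarrow> 'a) \<Rightarrow> 'w \<Rightarrow> real"
    and f :: "nat \<Rightarrow> (nat \<Rightarrow> 'a) \<Rightarrow> real \<Rightarrow> ennreal"
    and u :: "nat \<Rightarrow> (nat \<Rightarrow> 'a) \<Rightarrow> real"
  assumes "prob_space M"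
    and "N \<ge> 1"
    and "\<And>i. i \<in> {1..N} \<Longrightarrow> finite (S i) \<and> S i \<noteq> {}"
    and "\<And>i s. i \<in> {1..N} \<Longrightarrow> s \<in> Pi\<^sub>E {1..N} S \<Longrightarrow> distributed M lborel (U i s) (f i s)"
    and "\<And>i s. i \<in> {1..N} \<Longrightarrow> s \<in> Pi\<^sub>E {1..N} S \<Longrightarrow> has_bochner_integral M (U i s) (u i s)"
    and "prob_space.indep_vars M (\<lambda>_. borel) (\<lambda>(i, s). U i s) ({1..N} \<times> Pi\<^sub>E {1..N} S)"
  shows "\<exists>\<sigma>. risk_averse_equilibrium M N S U \<sigma>"
proof -
  interpret prob_space M by fact
  define c where "c i a t = \<P>(\<omega> in M. \<forall>b\<in>S i - {a}. U i (t(i := a)) \<omega> \<ge> U i (t(i := b)) \<omega>)"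
    for i a t
  \<comment> \<open>The polynomial is taken at arbitrary real weights, not only at probabilities,
    because the fixed point lemma asks for continuity on the whole space.\<close>
  define v where "v x i a = (\<Sum>t\<in>opponent_profiles N S i. (\<Prod>j\<in>{1..N} - {i}. x (j, t j)) * c i a t)"
    for x :: "nat \<times> 'a \<Rightarrow> real" and i a
  have v_cont: "continuous_on UNIV (\<lambda>x. v x i a)" for i a
    unfolding v_def by (intro continuous_intros continuous_on_product_coordinates)
  obtain x where x: "\<And>i a. i \<in> {1..N} \<Longrightarrow> a \<in> S i \<Longrightarrow> 0 \<le> x (i, a)"
    "\<And>i. i \<in> {1..N} \<Longrightarrow> (\<Sum>a\<in>S i. x (i, a)) = 1"
    "\<And>i a b. i \<in> {1..N} \<Longrightarrow> a \<in> S i \<Longrightarrow> b \<in> S i \<Longrightarrow> x (i, a) \<noteq> 0 \<Longrightarrow> v x i b \<le> v x i a"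
    using simplices_arg_max_fixpoint[of "{1..N}" S v] assms(3) v_cont by (metis finite_atLeastAtMost)
  have "\<exists>p. \<forall>a. pmf p a = (if a \<in> S i then x (i, a) else 0)" if "i \<in> {1..N}" for i
    using x that assms(3) by (intro ex_pmf_on_finite) auto
  then obtain p where p: "\<And>i a. i \<in> {1..N} \<Longrightarrow> pmf (p i) a = (if a \<in> S i then x (i, a) else 0)"
    by metis
  \<comment> \<open>Restriction makes the profile extensional, as membership in the product of the
    mixed strategy sets requires.\<close>
  define \<sigma> where "\<sigma> = restrict p {1..N}"
  have \<sigma>: "pmf (\<sigma> i) a = (if a \<in> S i then x (i, a) else 0)" if "i \<in> {1..N}" for i a
    using p[OF that] that by (simp add: \<sigma>_def)
  have supp: "set_pmf (\<sigma> i) = {a \<in> S i. x (i, a) \<noteq> 0}" if "i \<in> {1..N}" for i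
    using \<sigma>[OF that] by (auto simp: set_pmf_eq split: if_splits)
  have best: "prob_best M N S U i \<sigma> a = v x i a" if "i \<in> {1..N}" "a \<in> S i" for i a
  proof -
    have "opponent_prob N i \<sigma> t = (\<Prod>j\<in>{1..N} - {i}. x (j, t j))"
      if "t \<in> opponent_profiles N S i" for t
      unfolding opponent_prob_def using that
      by (intro prod.cong refl, subst \<sigma>) (auto simp: opponent_profiles_def PiE_mem)
    moreover have "U i s \<in> borel_measurable M" if "s \<in> Pi\<^sub>E {1..N} S" for s
      using assms(5)[OF \<open>i \<in> _\<close> that] by (auto simp: has_bochner_integral_iff)
    ultimately show ?thesis
      using that assms(3) by (subst prob_best_eq_sum) (auto simp: v_def c_def finite_measure_axioms)
  qed
  have "risk_averse_equilibrium M N S U \<sigma>"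
    unfolding risk_averse_equilibrium_def
  proof (intro conjI ballI PiE_I)
    fix i assume i: "i \<in> {1..N}"
    show "\<sigma> i \<in> mixed_strategies (S i)"
      using supp[OF i] by (auto simp: mixed_strategies_def)
    \<comment> \<open>By \<open>best\<close>, the third property of \<open>x\<close> says that each
      pure strategy of nonzero weight maximizes \<open>prob_best\<close> over
      \<open>S i\<close>.\<close>
    show "\<sigma> i \<in> risk_averse_best_response M N S U i \<sigma>"
      using supp[OF i] x(3)[OF i] best[OF i]
      by (auto simp: risk_averse_best_response_def is_arg_max_linorder)
  qed (auto simp: \<sigma>_def)
  then show ?thesis by blast
qed

end
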